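(* Let $G=(V,E)$ be a simple undirected graph, $S\subseteq\binom{V}{2}$, let $H=(W,F)$ be an induced subgraph of $G$, and let $S'=S\cap\binom{W}{2}$. Assume that for each $vw\in E\setminus F$ we have $\{v,w\}\notin S$, and that there is no $\{s,t\}\in S$ with $s\in W$ and $t$ adjacent to $W$. Let $a^{\mathsf T}x\geq b$ define a shared facet of $\mathrm{MultC}(H,S')$. Then $\sum_{e\in F}a_ex_e\geq b$ defines a shared facet of $\mathrm{MultC}(G,S)$.
   Context: Given a graph $G=(V,E)$ and $S\subseteq\binom{V}{2}$, an ($S$-)multicut is a set $\delta\subseteq E$ such that for every $\{s,t\}\in S$ the nodes $s$ and $t$ lie in different components of $G-\delta$. For $F\subseteq E$, $x^F\in\mathbb{R}^E$ is its incidence vector. The multicut polytope is $\mathrm{MultC}^{\square}(G,S)=\mathrm{conv}\{x^\delta:\delta\text{ an } S\text{-multicut}\}$ and the multicut dominant is $\mathrm{MultC}(G,S)=\mathrm{MultC}^{\square}(G,S)+\mathbb{R}^E_{\geq 0}$. A facet-defining inequality of $\mathrm{MultC}(G,S)$ defines a shared facet if it is also facet-defining for $\mathrm{MultC}^{\square}(G,S)$. "$t$ adjacent to $W$" means $t\notin W$ and $t$ has a neighbour in $W$. *)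

theory Defs
  imports "HOL-Analysis.Analysis" "HOL-Library.Ramsey"
begin

text \<open>
  Finite graphs are given by a vertex set \<open>V\<close> and an edge set \<open>E\<close> of two-element
  subsets of \<open>V\<close>, over an arbitrary finite type of potential vertices. \<open>[V]\<^bsup>2\<^esup>\<close> is the
  set of two-element subsets of \<open>V\<close>.
\<close>

definition simple_graph :: "'v set \<Rightarrow> 'v set set \<Rightarrow> bool" where
  "simple_graph V E \<longleftrightarrow> finite V \<and> E \<subseteq> [V]\<^bsup>2\<^esup>"

definition induced_subgraph :: "'v set \<Rightarrow> 'v set set \<Rightarrow> 'v set \<Rightarrow> 'v set set \<Rightarrow> bool" where
  "induced_subgraph W F V E \<longleftrightarrow> W \<subseteq> V \<and> F = E \<inter> [W]\<^bsup>2\<^esup>"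

definition adjacent_to :: "'v set set \<Rightarrow> 'v \<Rightarrow> 'v set \<Rightarrow> bool" where
  "adjacent_to E t W \<longleftrightarrow> t \<notin> W \<and> (\<exists>w\<in>W. {t, w} \<in> E)"

text \<open>The vertex set of the connected component of \<open>(V, E)\<close> containing \<open>v\<close>.\<close>

definition component :: "'v set \<Rightarrow> 'v set set \<Rightarrow> 'v \<Rightarrow> 'v set" where
  "component V E v = {w \<in> V. (v, w) \<in> {(x, y). {x, y} \<in> E}\<^sup>*}"

definition multicut :: "'v set \<Rightarrow> 'v set set \<Rightarrow> 'v set set \<Rightarrow> 'v set set \<Rightarrow> bool" where
  "multicut V E S \<delta> \<longleftrightarrow>
     \<delta> \<subseteq> E \<and> (\<forall>s t. {s, t} \<in> S \<longrightarrow> component V (E - \<delta>) s \<noteq> component V (E - \<delta>) t)"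

text \<open>
  Since \<open>E\<close> varies (over the graph and its subgraph), \<open>\<real>\<^sup>E\<close> is represented
  as the coordinate subspace of \<open>real ^ 'v set\<close> of all vectors vanishing outside \<open>E\<close>.
  The notions used below (convex hull, affine dimension, faces) do not depend on the ambient
  space.
\<close>

definition incidence_vector :: "'v::finite set set \<Rightarrow> real ^ 'v set" where
  "incidence_vector F = (\<chi> e. if e \<in> F then 1 else 0)"

definition nonneg_orthant :: "'v::finite set set \<Rightarrow> (real ^ 'v set) set" where
  "nonneg_orthant E = {x. (\<forall>e\<in>E. 0 \<le> x $ e) \<and> (\<forall>e. e \<notin> E \<longrightarrow> x $ e = 0)}"

definition multicut_polytope ::
    "'v::finite set \<Rightarrow> 'v set set \<Rightarrow> 'v set set \<Rightarrow> (real ^ 'v set) set" where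
  "multicut_polytope V E S = convex hull {incidence_vector \<delta> | \<delta>. multicut V E S \<delta>}"

definition multicut_dominant ::
    "'v::finite set \<Rightarrow> 'v set set \<Rightarrow> 'v set set \<Rightarrow> (real ^ 'v set) set" where
  "multicut_dominant V E S =
     {x + y | x y. x \<in> multicut_polytope V E S \<and> y \<in> nonneg_orthant E}"

text \<open>
  The linear inequality \<open>f x \<ge> b\<close> is facet-defining for \<open>P\<close>: it is valid, and the face of
  \<open>P\<close> where it is tight is a facet (nonempty, of dimension one less than that of \<open>P\<close>).
  \<open>P\<close> need not be full-dimensional.
\<close>

definition facet_defining :: "'a::euclidean_space set \<Rightarrow> ('a \<Rightarrow> real) \<Rightarrow> real \<Rightarrow> bool" where
  "facet_defining P f b \<longleftrightarrow>
     linear f \<and> (\<forall>x\<in>P. f x \<ge> b) \<and> {x \<in> P. f x = b} facet_of P"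

definition defines_shared_facet ::
    "'v::finite set \<Rightarrow> 'v set set \<Rightarrow> 'v set set \<Rightarrow> (real ^ 'v set \<Rightarrow> real) \<Rightarrow> real \<Rightarrow> bool" where
  "defines_shared_facet V E S f b \<longleftrightarrow>
     facet_defining (multicut_dominant V E S) f b \<and>
     facet_defining (multicut_polytope V E S) f b"

end

theory Submission
  imports Defs
begin

text \<open>
  Put \<open>D = E - F\<close>. Restricting an \<open>S\<close>-multicut of \<open>G\<close> to \<open>F\<close> gives an \<open>S'\<close>-multicut of \<open>H\<close>;
  conversely, adding to an \<open>S'\<close>-multicut of \<open>H\<close> either all of \<open>D\<close>, or all of \<open>D\<close> but one edge,
  gives an \<open>S\<close>-multicut of \<open>G\<close>, because an edge of \<open>D\<close> that is kept merely hangs a vertex outside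
  \<open>W\<close> onto the rest. Hence the polytope, the dominant, and the faces of both on which the
  inequality is tight all gain exactly \<open>|D|\<close> dimensions in passing from \<open>H\<close> to \<open>G\<close>, so
  codimension one is preserved.
\<close>

section \<open>Connectivity by walks\<close>

abbreviation edge_rel :: "'v set set \<Rightarrow> ('v \<times> 'v) set" where
  "edge_rel E \<equiv> {(x, y). {x, y} \<in> E}"

lemma edge_rel_rtrancl_sym: "(x, y) \<in> (edge_rel E)\<^sup>* \<Longrightarrow> (y, x) \<in> (edge_rel E)\<^sup>*"
  by (rule symD[OF sym_rtrancl]) (auto simp: sym_def insert_commute)

lemma pair_in_nsets: "{s, t} \<in> [V]\<^bsup>2\<^esup> \<longleftrightarrow> s \<in> V \<and> t \<in> V \<and> s \<noteq> t"
  by (auto simp: nsets_def card_2_iff doubleton_eq_iff)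

lemma subset_nsets_pairD: "A \<subseteq> [V]\<^bsup>2\<^esup> \<Longrightarrow> {s, t} \<in> A \<Longrightarrow> s \<in> V \<and> t \<in> V \<and> s \<noteq> t"
  using pair_in_nsets subsetD by metis

text \<open>Membership of \<open>s\<close> in \<open>V\<close> puts \<open>s\<close> into its own
  component, so equality of the two components yields a walk; conversely, reachability is an
  equivalence relation.\<close>

lemma component_eq_iff:
  assumes "s \<in> V"
  shows "component V E s = component V E t \<longleftrightarrow> (s, t) \<in> (edge_rel E)\<^sup>*"
proof
  assume "component V E s = component V E t"
  moreover have "s \<in> component V E s"
    using assms by (simp add: component_def)
  ultimately have "(t, s) \<in> (edge_rel E)\<^sup>*"
    by (simp add: component_def)
  then show "(s, t) \<in> (edge_rel E)\<^sup>*"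
    by (rule edge_rel_rtrancl_sym)
next
  assume "(s, t) \<in> (edge_rel E)\<^sup>*"
  then have "(s, v) \<in> (edge_rel E)\<^sup>* \<longleftrightarrow> (t, v) \<in> (edge_rel E)\<^sup>*" for v
    using rtrancl_trans[of s t "edge_rel E" v] rtrancl_trans[of t s "edge_rel E" v]
      edge_rel_rtrancl_sym[of s t E] by argo
  then show "component V E s = component V E t"
    by (simp add: component_def)
qed

text \<open>Replaces components by walks, so that changes of the edge set can be handled through
  reachability alone. Pairs of \<open>S\<close> lie in \<open>V\<close>, which gives the premise of
  \<open>component_eq_iff\<close>.\<close>

lemma multicut_iff:
  assumes "S \<subseteq> [V]\<^bsup>2\<^esup>"
  shows "multicut V E S \<delta> \<longleftrightarrow>
    \<delta> \<subseteq> E \<and> (\<forall>s t. {s, t} \<in> S \<longrightarrow> (s, t) \<notin> (edge_rel (E - \<delta>))\<^sup>*)"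
proof -
  have "component V (E - \<delta>) s \<noteq> component V (E - \<delta>) t \<longleftrightarrow> (s, t) \<notin> (edge_rel (E - \<delta>))\<^sup>*"
    if "{s, t} \<in> S" for s t
    using component_eq_iff[of s V] subset_nsets_pairD[OF assms that] by simp
  then show ?thesis
    unfolding multicut_def by blast
qed

lemma edge_rel_rtrancl_mono: "A \<subseteq> B \<Longrightarrow> (x, y) \<in> (edge_rel A)\<^sup>* \<Longrightarrow> (x, y) \<in> (edge_rel B)\<^sup>*"
  using rtrancl_mono[of "edge_rel A" "edge_rel B"] by blast

text \<open>A walk with distinct ends has a first and a last edge, and both lie inside
  \<open>W\<close>. The condition \<open>x \<noteq> y\<close> rules out the trivial walk, which
  exists at every vertex.\<close>

lemma edge_rel_rtrancl_in_vertices: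
  assumes "(x, y) \<in> (edge_rel A)\<^sup>*" "A \<subseteq> [W]\<^bsup>2\<^esup>" "x \<noteq> y"
  shows "x \<in> W \<and> y \<in> W"
proof -
  have W: "u \<in> W \<and> v \<in> W" if "(u, v) \<in> edge_rel A" for u v
    using subset_nsets_pairD[OF assms(2), of u v] that by simp
  from assms(1,3) have "(x, y) \<in> (edge_rel A)\<^sup>+"
    by (simp add: rtrancl_eq_or_trancl)
  then show ?thesis
    using W by (induction rule: trancl_induct) auto
qed

section \<open>Restricting and extending multicuts\<close>

lemma multicut_restrict:
  assumes "S \<subseteq> [V]\<^bsup>2\<^esup>" "F \<subseteq> E" "multicut V E S \<delta>"
  shows "multicut W F (S \<inter> [W]\<^bsup>2\<^esup>) (\<delta> \<inter> F)"
proof -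
  have "F - \<delta> \<inter> F \<subseteq> E - \<delta>"
    using assms(2) by blast
  then have "(s, t) \<notin> (edge_rel (F - \<delta> \<inter> F))\<^sup>*" if "{s, t} \<in> S" for s t
    using assms(1,3) that edge_rel_rtrancl_mono[of "F - \<delta> \<inter> F" "E - \<delta>" s t]
    by (auto simp: multicut_iff)
  then show ?thesis
    by (simp add: multicut_iff)
qed

text \<open>Once all of \<open>E - F\<close> is cut, only the edges \<open>F - \<delta>\<close>
  remain. They lie inside \<open>W\<close>, so a pair of \<open>S\<close> not contained in
  \<open>W\<close> is separated trivially; the other pairs are separated by
  \<open>\<delta>\<close>.\<close>

lemma multicut_extend:
  assumes "S \<subseteq> [V]\<^bsup>2\<^esup>" "F \<subseteq> E" "F \<subseteq> [W]\<^bsup>2\<^esup>"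
    and "multicut W F (S \<inter> [W]\<^bsup>2\<^esup>) \<delta>"
  shows "multicut V E S (\<delta> \<union> (E - F))"
proof -
  have \<delta>: "\<delta> \<subseteq> F" "\<And>s t. {s, t} \<in> S \<inter> [W]\<^bsup>2\<^esup> \<Longrightarrow> (s, t) \<notin> (edge_rel (F - \<delta>))\<^sup>*"
    using assms(4) multicut_iff[of "S \<inter> [W]\<^bsup>2\<^esup>" W F \<delta>] by auto
  have "(s, t) \<notin> (edge_rel (E - (\<delta> \<union> (E - F))))\<^sup>*" if "{s, t} \<in> S" for s t
  proof
    assume "(s, t) \<in> (edge_rel (E - (\<delta> \<union> (E - F))))\<^sup>*"
    then have st: "(s, t) \<in> (edge_rel (F - \<delta>))\<^sup>*"
      by (rule edge_rel_rtrancl_mono[rotated]) auto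
    have "s \<noteq> t"
      using subset_nsets_pairD[OF assms(1) that] by simp
    then have "s \<in> W \<and> t \<in> W"
      using edge_rel_rtrancl_in_vertices[OF st] assms(3) by blast
    then show False
      using \<delta>(2)[of s t] st that \<open>s \<noteq> t\<close> by (simp add: pair_in_nsets)
  qed
  then show ?thesis
    using \<delta>(1) assms(1,2) by (auto simp: multicut_iff)
qed

text \<open>No edge of \<open>F\<close> meets \<open>q\<close>, so the kept edge makes
  \<open>q\<close> a pendant vertex at \<open>p\<close>, and pairs of \<open>S\<close> avoiding
  \<open>q\<close> stay separated. A pair \<open>{q, t}\<close> could be joined only through
  \<open>p\<close>: the case \<open>t = p\<close> is excluded by \<open>{p, q} \<notin> S\<close>,
  and otherwise \<open>p\<close> and \<open>t\<close> lie in \<open>W\<close>, so that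
  \<open>q\<close> is adjacent to \<open>W\<close> and paired with \<open>t\<close>, against
  \<open>adj\<close>.\<close>

lemma multicut_extend_except:
  assumes "S \<subseteq> [V]\<^bsup>2\<^esup>" "F \<subseteq> E" "F \<subseteq> [W]\<^bsup>2\<^esup>"
    and "multicut W F (S \<inter> [W]\<^bsup>2\<^esup>) \<delta>"
    and e: "{p, q} \<in> E - F" "p \<noteq> q" "q \<notin> W" "{p, q} \<notin> S"
    and adj: "\<not> (\<exists>s t. {s, t} \<in> S \<and> s \<in> W \<and> adjacent_to E t W)"
  shows "multicut V E S (\<delta> \<union> (E - F - {{p, q}}))"
proof -
  have \<delta>: "\<delta> \<subseteq> F" "\<And>s t. {s, t} \<in> S \<inter> [W]\<^bsup>2\<^esup> \<Longrightarrow> (s, t) \<notin> (edge_rel (F - \<delta>))\<^sup>*"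
    using assms(4) multicut_iff[of "S \<inter> [W]\<^bsup>2\<^esup>" W F \<delta>] by auto
  \<comment> \<open>Contracting the kept edge onto \<open>p\<close> turns walks of \<open>G\<close> into walks of \<open>H\<close>.\<close>
  define g where "g x = (if x = q then p else x)" for x
  have g_step: "(g x, g y) \<in> (edge_rel (F - \<delta>))\<^sup>*" if "{x, y} \<in> insert {p, q} (F - \<delta>)" for x y
  proof (cases "{x, y} = {p, q}")
    case True
    then have "g x = g y"
      by (auto simp: g_def doubleton_eq_iff)
    then show ?thesis by simp
  next
    case False
    then have xy: "{x, y} \<in> F - \<delta>"
      using that by blast
    then have "x \<in> W \<and> y \<in> W"
      using subset_nsets_pairD[OF assms(3), of x y] by simp
    then have "g x = x" "g y = y"
      using e(3) by (auto simp: g_def)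
    then show ?thesis
      using xy by auto
  qed
  have g_walk: "(g x, g y) \<in> (edge_rel (F - \<delta>))\<^sup>*"
    if "(x, y) \<in> (edge_rel (insert {p, q} (F - \<delta>)))\<^sup>*" for x y
    using that
  proof (induction rule: rtrancl_induct)
    case (step y z)
    then show ?case
      using g_step[of y z] by (auto intro: rtrancl_trans)
  qed simp
  have not_q: False
    if "{q, t} \<in> S" "(q, t) \<in> (edge_rel (insert {p, q} (F - \<delta>)))\<^sup>*" for t
  proof -
    have "t \<noteq> q"
      using subset_nsets_pairD[OF assms(1) that(1)] by auto
    then have pt: "(p, t) \<in> (edge_rel (F - \<delta>))\<^sup>*"
      using g_walk[OF that(2)] by (simp add: g_def)
    have "p \<noteq> t"
      using that(1) e(4) by (auto simp: insert_commute)
    then have "p \<in> W" "t \<in> W"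
      using edge_rel_rtrancl_in_vertices[OF pt] assms(3) by blast+
    moreover have "{q, p} \<in> E" "{t, q} \<in> S"
      using e(1) that(1) by (auto simp: insert_commute)
    ultimately show False
      using adj e(3) unfolding adjacent_to_def by blast
  qed
  have "(s, t) \<notin> (edge_rel (E - (\<delta> \<union> (E - F - {{p, q}}))))\<^sup>*" if st: "{s, t} \<in> S" for s t
  proof
    assume "(s, t) \<in> (edge_rel (E - (\<delta> \<union> (E - F - {{p, q}}))))\<^sup>*"
    then have walk: "(s, t) \<in> (edge_rel (insert {p, q} (F - \<delta>)))\<^sup>*"
      by (rule edge_rel_rtrancl_mono[rotated]) auto
    have "s \<noteq> q"
      using not_q[of t] st walk by blast
    moreover have "t \<noteq> q"
      using not_q[of s] st edge_rel_rtrancl_sym[OF walk] by (auto simp: insert_commute)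
    ultimately have st': "(s, t) \<in> (edge_rel (F - \<delta>))\<^sup>*"
      using g_walk[OF walk] by (simp add: g_def)
    have "s \<noteq> t"
      using subset_nsets_pairD[OF assms(1) st] by simp
    then have "s \<in> W \<and> t \<in> W"
      using edge_rel_rtrancl_in_vertices[OF st'] assms(3) by blast
    then show False
      using \<delta>(2)[of s t] st st' \<open>s \<noteq> t\<close> by (simp add: pair_in_nsets)
  qed
  then show ?thesis
    using \<delta>(1) assms(1,2) by (auto simp: multicut_iff)
qed

section \<open>Dimension count under coordinate projection\<close>

definition restrict_coords :: "'i::finite set \<Rightarrow> real ^ 'i \<Rightarrow> real ^ 'i" where
  "restrict_coords F x = (\<chi> e. if e \<in> F then x $ e else 0)"

lemma restrict_coords_nth [simp]: "restrict_coords F x $ e = (if e \<in> F then x $ e else 0)"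
  by (simp add: restrict_coords_def)

lemma incidence_vector_nth [simp]: "incidence_vector F $ e = (if e \<in> F then 1 else 0)"
  by (simp add: incidence_vector_def)

lemma linear_restrict_coords: "linear (restrict_coords F)"
  by (rule linearI) (auto simp: vec_eq_iff)

lemma restrict_coords_incidence_vector:
  "restrict_coords F (incidence_vector \<delta>) = incidence_vector (\<delta> \<inter> F)"
  by (auto simp: vec_eq_iff)

text \<open>The direction space of \<open>Q\<close> is the orthogonal sum of that of
  \<open>P\<close> and the span of the unit vectors of \<open>E - F\<close>. Here
  \<open>proj\<close> gives the upper bound, \<open>lift\<close> supplies the directions of
  \<open>P\<close>, and comparing \<open>lift\<close> with \<open>lift_except\<close> supplies the
  unit vectors. The sets are arbitrary so that tight faces are covered too.\<close>

lemma aff_dim_lift: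
  fixes P Q :: "(real ^ ('v::finite) set) set"
  assumes P: "\<And>x e. x \<in> P \<Longrightarrow> e \<notin> F \<Longrightarrow> x $ e = 0"
    and Q: "\<And>x e. x \<in> Q \<Longrightarrow> e \<notin> E \<Longrightarrow> x $ e = 0"
    and "F \<subseteq> E" "P \<noteq> {}"
    and proj: "\<And>x. x \<in> Q \<Longrightarrow> restrict_coords F x \<in> P"
    and lift: "\<And>x. x \<in> P \<Longrightarrow> x + incidence_vector (E - F) \<in> Q"
    and lift_except: "\<And>x e. x \<in> P \<Longrightarrow> e \<in> E - F \<Longrightarrow> x + incidence_vector (E - F - {e}) \<in> Q"
  shows "aff_dim Q = aff_dim P + int (card (E - F))"
proof -
  obtain x0 where x0: "x0 \<in> P"
    using assms(4) by blast
  \<comment> \<open>The base point of \<open>Q\<close> is the lift of that of \<open>P\<close>, so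
    that differences in \<open>P\<close> reappear unchanged as differences in
    \<open>Q\<close>.\<close>
  define y0 where "y0 = x0 + incidence_vector (E - F)"
  have y0: "y0 \<in> Q"
    unfolding y0_def using x0 by (rule lift)
  define PD where "PD = (\<lambda>x. - x0 + x) ` P"
  define QD where "QD = (\<lambda>x. - y0 + x) ` Q"
  define A where "A = (\<lambda>e. axis e (1::real)) ` (E - F)"
  have dimA: "dim A = card (E - F)"
  proof -
    have "inj_on (\<lambda>e. axis e (1::real)) (E - F)"
      by (auto simp: inj_on_def axis_eq_axis)
    moreover have "independent A"
      unfolding A_def
      by (rule independent_mono[OF independent_Basis]) auto
    ultimately show ?thesis
      unfolding A_def by (simp add: dim_eq_card_independent card_image)
  qed
  have "orthogonal u v" if "u \<in> PD" "v \<in> A" for u v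
  proof -
    from \<open>v \<in> A\<close> obtain e where e: "e \<in> E - F" "v = axis e 1"
      unfolding A_def by blast
    with \<open>u \<in> PD\<close> have "u $ e = 0"
      unfolding PD_def using P x0 by auto
    then show ?thesis
      using e by (simp add: orthogonal_def inner_axis)
  qed
  then have dim_sum: "dim (PD \<union> A) = dim PD + dim A"
    by (intro dim_orthogonal_sum) (auto simp: orthogonal_def)
  have "QD \<subseteq> span (PD \<union> A)"
  proof
    fix u assume "u \<in> QD"
    then obtain y where y: "y \<in> Q" "u = - y0 + y"
      unfolding QD_def by blast
    \<comment> \<open>The point \<open>y0\<close> agrees with \<open>x0\<close> on \<open>F\<close>
      and equals \<open>1\<close> on \<open>E - F\<close>, where \<open>x0\<close> vanishes; hence
      the coefficients \<open>y $ e - 1\<close>.\<close>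
    have "u = (- x0 + restrict_coords F y) + (\<Sum>e\<in>E - F. (y $ e - 1) *\<^sub>R axis e 1)"
    proof (rule vec_eq_iff[THEN iffD2], rule allI)
      fix i
      have "(\<Sum>e\<in>E - F. (y $ e - 1) *\<^sub>R axis e (1::real)) $ i
          = (\<Sum>e\<in>E - F. if e = i then y $ e - 1 else 0)"
        unfolding sum_component by (intro sum.cong) (auto simp: axis_def)
      also have "\<dots> = (if i \<in> E - F then y $ i - 1 else 0)"
        by (simp add: sum.delta)
      finally have *: "(\<Sum>e\<in>E - F. (y $ e - 1) *\<^sub>R axis e (1::real)) $ i
          = (if i \<in> E - F then y $ i - 1 else 0)" .
      show "u $ i = ((- x0 + restrict_coords F y)
          + (\<Sum>e\<in>E - F. (y $ e - 1) *\<^sub>R axis e 1)) $ i"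
        unfolding vector_add_component *
        using y(2) Q[OF y(1), of i] P[OF x0, of i] assms(3)
        by (auto simp: y0_def simp del: sum_component)
    qed
    moreover have "- x0 + restrict_coords F y \<in> span (PD \<union> A)"
      by (rule span_base) (use proj[OF y(1)] in \<open>auto simp: PD_def\<close>)
    moreover have "(\<Sum>e\<in>E - F. (y $ e - 1) *\<^sub>R axis e 1) \<in> span (PD \<union> A)"
      by (intro span_sum span_scale span_base) (auto simp: A_def)
    ultimately show "u \<in> span (PD \<union> A)"
      by (simp only: span_add)
  qed
  moreover have "PD \<subseteq> span QD"
  proof
    fix u assume "u \<in> PD"
    then obtain x where x: "x \<in> P" "u = - x0 + x"
      unfolding PD_def by blast
    then have "u = - y0 + (x + incidence_vector (E - F))"
      by (simp add: y0_def)
    then show "u \<in> span QD"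
      using lift[OF x(1)] by (auto simp: QD_def intro!: span_base)
  qed
  moreover have "A \<subseteq> span QD"
  proof
    fix u assume "u \<in> A"
    then obtain e where e: "e \<in> E - F" "u = axis e 1"
      unfolding A_def by blast
    \<comment> \<open>Lifting \<open>x0\<close> by all of \<open>E - F\<close> and by all but
      \<open>e\<close> gives two points of \<open>Q\<close> that differ by the unit vector of
      \<open>e\<close>.\<close>
    then have "u = - (- y0 + (x0 + incidence_vector (E - F - {e})))"
      by (auto simp: y0_def vec_eq_iff axis_def)
    moreover have "- y0 + (x0 + incidence_vector (E - F - {e})) \<in> span QD"
      using lift_except[OF x0 e(1)] by (auto simp: QD_def intro!: span_base)
    ultimately show "u \<in> span QD"
      by (simp only: span_neg)
  qed
  ultimately have "span QD = span (PD \<union> A)"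
    by (simp add: span_eq)
  then have "dim QD = dim (PD \<union> A)"
    using dim_span[of QD] dim_span[of "PD \<union> A"] by simp
  moreover have "aff_dim P = int (dim PD)"
    unfolding PD_def using x0 by (intro aff_dim_eq_dim) (simp add: hull_inc)
  moreover have "aff_dim Q = int (dim QD)"
    unfolding QD_def using y0 by (intro aff_dim_eq_dim) (simp add: hull_inc)
  ultimately show ?thesis
    using dim_sum dimA by simp
qed

section \<open>Lifting faces and facets\<close>

lemma face_of_linear_ge:
  fixes f :: "'a::euclidean_space \<Rightarrow> real"
  assumes "convex P" "linear f" "\<And>x. x \<in> P \<Longrightarrow> f x \<ge> b"
  shows "{x \<in> P. f x = b} face_of P"
proof -
  \<comment> \<open>The vector \<open>adjoint f 1\<close> represents the functional
    \<open>f\<close>, which turns the inequality into a halfspace given by an inner product.\<close>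
  have f: "f x = adjoint f 1 \<bullet> x" for x
    using adjoint_works[OF assms(2), of x 1] by (simp add: inner_commute)
  have "P \<inter> {x. adjoint f 1 \<bullet> x = b} face_of P"
    using assms(1,3) by (intro face_of_Int_supporting_hyperplane_ge) (auto simp: f)
  moreover have "P \<inter> {x. adjoint f 1 \<bullet> x = b} = {x \<in> P. f x = b}"
    by (auto simp: f)
  ultimately show ?thesis by simp
qed

text \<open>Since \<open>f\<close> sees only the coordinates in \<open>F\<close>, validity passes to
  \<open>Q\<close> by projecting, and the maps between \<open>P\<close> and \<open>Q\<close>
  preserve tightness. So \<open>aff_dim_lift\<close> applies to the sets and to their tight faces
  with the same gain, and codimension one survives.\<close>

lemma facet_defining_lift:
  fixes P Q :: "(real ^ ('v::finite) set) set"
  assumes P: "\<And>x e. x \<in> P \<Longrightarrow> e \<notin> F \<Longrightarrow> x $ e = 0"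
    and Q: "\<And>x e. x \<in> Q \<Longrightarrow> e \<notin> E \<Longrightarrow> x $ e = 0"
    and "convex Q" "F \<subseteq> E"
    and proj: "\<And>x. x \<in> Q \<Longrightarrow> restrict_coords F x \<in> P"
    and lift: "\<And>x. x \<in> P \<Longrightarrow> x + incidence_vector (E - F) \<in> Q"
    and lift_except: "\<And>x e. x \<in> P \<Longrightarrow> e \<in> E - F \<Longrightarrow> x + incidence_vector (E - F - {e}) \<in> Q"
    and f_proj: "\<And>x. f (restrict_coords F x) = f x"
    and facet: "facet_defining P f b"
  shows "facet_defining Q f b"
proof -
  have f_lin: "linear f" and valid: "\<And>x. x \<in> P \<Longrightarrow> f x \<ge> b"
    and face: "{x \<in> P. f x = b} facet_of P"
    using facet by (auto simp: facet_defining_def)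
  have f_add: "f (x + incidence_vector D) = f x" if "D \<inter> F = {}" for x D
  proof -
    have "restrict_coords F (x + incidence_vector D) = restrict_coords F x"
      using that by (auto simp: vec_eq_iff)
    then show ?thesis
      using f_proj by metis
  qed
  have f_lift: "f (x + incidence_vector (E - F)) = f x"
    and f_lift_except: "f (x + incidence_vector (E - F - {e})) = f x" for x e
    by (rule f_add, blast)+
  have valid_Q: "f x \<ge> b" if "x \<in> Q" for x
    using valid[OF proj[OF that]] f_proj by simp
  have nonempty: "{x \<in> P. f x = b} \<noteq> {}"
    and codim: "aff_dim {x \<in> P. f x = b} = aff_dim P - 1"
    using face by (auto simp: facet_of_def)
  have "aff_dim Q = aff_dim P + int (card (E - F))"
  proof (rule aff_dim_lift)
    show "P \<noteq> {}"
      using nonempty by blast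
  qed (fact P Q proj lift lift_except \<open>F \<subseteq> E\<close>)+
  moreover have "aff_dim {x \<in> Q. f x = b} = aff_dim {x \<in> P. f x = b} + int (card (E - F))"
  proof (rule aff_dim_lift)
    show "{x \<in> P. f x = b} \<noteq> {}" "F \<subseteq> E"
      by fact+
  qed (simp_all add: P Q proj lift lift_except f_proj f_lift f_lift_except)
  moreover have "{x \<in> Q. f x = b} \<noteq> {}"
    using nonempty lift f_lift by fastforce
  ultimately have "{x \<in> Q. f x = b} facet_of Q"
    using face_of_linear_ge[OF \<open>convex Q\<close> f_lin valid_Q] codim by (simp add: facet_of_def)
  then show ?thesis
    using f_lin valid_Q by (simp add: facet_defining_def)
qed

section \<open>Polytope and dominant under restriction and translation\<close>

lemma multicut_polytope_eq:
  "multicut_polytope V E S = convex hull (incidence_vector ` {\<delta>. multicut V E S \<delta>})"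
  unfolding multicut_polytope_def by (rule arg_cong[where f = "(hull) convex"]) blast

text \<open>The hyperplane \<open>x $ e = 0\<close> is convex and contains every generator.\<close>

lemma multicut_polytope_support:
  assumes "x \<in> multicut_polytope V E S" "e \<notin> E"
  shows "x $ e = 0"
proof -
  have "multicut_polytope V E S \<subseteq> {x. x $ e = 0}"
    unfolding multicut_polytope_eq
  proof (rule hull_minimal)
    show "incidence_vector ` {\<delta>. multicut V E S \<delta>} \<subseteq> {x. x $ e = 0}"
      using assms(2) by (auto simp: multicut_def)
    show "convex {x :: real ^ 'a set. x $ e = 0}"
      by (auto simp: convex_def)
  qed
  then show ?thesis
    using assms(1) by blast
qed

text \<open>Linear maps commute with convex hulls, so only generators matter: the incidence vector
  of \<open>\<delta>\<close> is projected to that of \<open>\<delta> \<inter> F\<close>.\<close>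

lemma multicut_polytope_restrict:
  assumes "\<And>\<delta>. multicut V E S \<delta> \<Longrightarrow> multicut W F S' (\<delta> \<inter> F)"
    and "x \<in> multicut_polytope V E S"
  shows "restrict_coords F x \<in> multicut_polytope W F S'"
proof -
  have "restrict_coords F ` multicut_polytope V E S
      = convex hull (restrict_coords F ` incidence_vector ` {\<delta>. multicut V E S \<delta>})"
    unfolding multicut_polytope_eq
    by (rule convex_hull_linear_image[OF linear_restrict_coords])
  also have "\<dots> \<subseteq> multicut_polytope W F S'"
    unfolding multicut_polytope_eq using assms(1)
    by (intro hull_mono) (auto simp: restrict_coords_incidence_vector)
  finally show ?thesis
    using assms(2) by blast
qed

text \<open>Translations commute with convex hulls, and since \<open>\<delta> \<subseteq> F\<close>
  is disjoint from \<open>D\<close>, the incidence vectors add up to that of the union. Taking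
  \<open>D\<close> to be \<open>E - F\<close> or \<open>E - F - {e}\<close> gives both kinds of
  lift.\<close>

lemma multicut_polytope_translate:
  assumes "\<And>\<delta>. multicut W F S' \<delta> \<Longrightarrow> multicut V E S (\<delta> \<union> D)" "D \<inter> F = {}"
    and "x \<in> multicut_polytope W F S'"
  shows "x + incidence_vector D \<in> multicut_polytope V E S"
proof -
  have *: "incidence_vector D + incidence_vector \<delta> = incidence_vector (\<delta> \<union> D)"
    if "multicut W F S' \<delta>" for \<delta>
    using that assms(2) by (auto simp: vec_eq_iff multicut_def)
  have "(+) (incidence_vector D) ` multicut_polytope W F S'
      = convex hull ((+) (incidence_vector D) ` incidence_vector ` {\<delta>. multicut W F S' \<delta>})"
    unfolding multicut_polytope_eq by (rule convex_hull_translation[symmetric])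
  also have "\<dots> \<subseteq> multicut_polytope V E S"
    unfolding multicut_polytope_eq using assms(1)
    by (intro hull_mono) (auto simp: *)
  finally show ?thesis
    using assms(3) by (auto simp: add.commute)
qed

lemma convex_multicut_polytope: "convex (multicut_polytope V E S)"
  by (simp add: multicut_polytope_def)

lemma convex_multicut_dominant: "convex (multicut_dominant V E S)"
proof -
  have "convex (nonneg_orthant E)"
    by (auto simp: convex_def nonneg_orthant_def)
  \<comment> \<open>The double union writes the dominant as a Minkowski sum in the shape of
    \<open>convex_sums\<close>.\<close>
  then have "convex (\<Union>x\<in>multicut_polytope V E S. \<Union>y\<in>nonneg_orthant E. {x + y})"
    by (intro convex_sums convex_multicut_polytope)
  also have "(\<Union>x\<in>multicut_polytope V E S. \<Union>y\<in>nonneg_orthant E. {x + y})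
      = multicut_dominant V E S"
    by (auto simp: multicut_dominant_def)
  finally show ?thesis .
qed

lemma multicut_dominant_support:
  "x \<in> multicut_dominant V E S \<Longrightarrow> e \<notin> E \<Longrightarrow> x $ e = 0"
  by (auto simp: multicut_dominant_def nonneg_orthant_def multicut_polytope_support)

text \<open>Both summands are projected separately, and the orthant of \<open>E\<close> is mapped
  into the orthant of \<open>F\<close>.\<close>

lemma multicut_dominant_restrict:
  assumes "\<And>\<delta>. multicut V E S \<delta> \<Longrightarrow> multicut W F S' (\<delta> \<inter> F)" "F \<subseteq> E"
    and "x \<in> multicut_dominant V E S"
  shows "restrict_coords F x \<in> multicut_dominant W F S'"
proof -
  obtain u v where uv: "u \<in> multicut_polytope V E S" "v \<in> nonneg_orthant E" "x = u + v"
    using assms(3) by (auto simp: multicut_dominant_def)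
  have "restrict_coords F v \<in> nonneg_orthant F"
    using uv(2) assms(2) by (auto simp: nonneg_orthant_def)
  moreover have "restrict_coords F u \<in> multicut_polytope W F S'"
    using assms(1) uv(1) by (rule multicut_polytope_restrict)
  moreover have "restrict_coords F x = restrict_coords F u + restrict_coords F v"
    unfolding uv(3) by (rule linear_add[OF linear_restrict_coords])
  ultimately show ?thesis
    by (auto simp: multicut_dominant_def)
qed

text \<open>Only the polytope part is shifted; the orthant part is kept, since a nonnegative vector
  supported on \<open>F\<close> also lies in the orthant of \<open>E\<close>.\<close>

lemma multicut_dominant_translate:
  assumes "\<And>\<delta>. multicut W F S' \<delta> \<Longrightarrow> multicut V E S (\<delta> \<union> D)" "D \<inter> F = {}" "F \<subseteq> E"
    and "x \<in> multicut_dominant W F S'"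
  shows "x + incidence_vector D \<in> multicut_dominant V E S"
proof -
  obtain u v where uv: "u \<in> multicut_polytope W F S'" "v \<in> nonneg_orthant F" "x = u + v"
    using assms(4) by (auto simp: multicut_dominant_def)
  have "u + incidence_vector D \<in> multicut_polytope V E S"
    using assms(1,2) uv(1) by (rule multicut_polytope_translate)
  moreover have "v \<in> nonneg_orthant E"
    using uv(2) assms(3) unfolding nonneg_orthant_def by force
  moreover have "x + incidence_vector D = (u + incidence_vector D) + v"
    using uv(3) by simp
  ultimately show ?thesis
    unfolding multicut_dominant_def by blast
qed

section \<open>Transfer of shared facets from the induced subgraph to the whole graph\<close>

theorem theorem3p10:
  fixes V W :: "'v::finite set" and E F S S' :: "'v set set"
    and a :: "'v set \<Rightarrow> real" and b :: real
  assumes "simple_graph V E"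
    and "S \<subseteq> [V]\<^bsup>2\<^esup>"
    and "induced_subgraph W F V E"
    and "S' = S \<inter> [W]\<^bsup>2\<^esup>"
    and "\<And>v w. {v, w} \<in> E - F \<Longrightarrow> {v, w} \<notin> S"
    and "\<not> (\<exists>s t. {s, t} \<in> S \<and> s \<in> W \<and> adjacent_to E t W)"
    and "defines_shared_facet W F S' (\<lambda>x. \<Sum>e\<in>F. a e * x $ e) b"
  shows "defines_shared_facet V E S (\<lambda>x. \<Sum>e\<in>F. a e * x $ e) b"
proof -
  have F: "F \<subseteq> E" "F \<subseteq> [W]\<^bsup>2\<^esup>" and F_eq: "F = E \<inter> [W]\<^bsup>2\<^esup>"
    using assms(3) by (auto simp: induced_subgraph_def)
  have restrict: "multicut W F S' (\<delta> \<inter> F)" if "multicut V E S \<delta>" for \<delta>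
    unfolding assms(4) using assms(2) F(1) that by (rule multicut_restrict)
  have extend: "multicut V E S (\<delta> \<union> (E - F))" if "multicut W F S' \<delta>" for \<delta>
    using assms(2) F that[unfolded assms(4)] by (rule multicut_extend)
  have extend_except: "multicut V E S (\<delta> \<union> (E - F - {e}))"
    if "e \<in> E - F" "multicut W F S' \<delta>" for \<delta> e
  proof -
    have "e \<in> [V]\<^bsup>2\<^esup>"
      using assms(1) that(1) by (auto simp: simple_graph_def)
    then obtain u v where uv: "e = {u, v}" "u \<noteq> v"
      by (auto simp: nsets_def card_2_iff)
    \<comment> \<open>As \<open>F\<close> contains every edge of \<open>E\<close> inside
      \<open>W\<close>, an edge of \<open>E - F\<close> has an end outside \<open>W\<close>; it
      becomes the pendant vertex \<open>q\<close>.\<close>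
    have "u \<notin> W \<or> v \<notin> W"
      using that(1) uv F_eq by (auto simp: pair_in_nsets)
    then obtain p q where pq: "e = {p, q}" "p \<noteq> q" "q \<notin> W"
      using uv by (metis insert_commute)
    have "{p, q} \<in> E - F"
      using that(1) pq(1) by simp
    then show ?thesis
      unfolding pq(1) using assms(2,5,6) F that(2)[unfolded assms(4)] pq(2,3)
      by (intro multicut_extend_except) auto
  qed
  have disjoint: "(E - F) \<inter> F = {}" "(E - F - {e}) \<inter> F = {}" for e
    by auto
  have f_proj: "(\<Sum>e\<in>F. a e * restrict_coords F x $ e) = (\<Sum>e\<in>F. a e * x $ e)" for x
    by simp
  have "facet_defining (multicut_dominant V E S) (\<lambda>x. \<Sum>e\<in>F. a e * x $ e) b"
  proof (rule facet_defining_lift)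
    show "facet_defining (multicut_dominant W F S') (\<lambda>x. \<Sum>e\<in>F. a e * x $ e) b"
      using assms(7) by (simp add: defines_shared_facet_def)
    show "restrict_coords F x \<in> multicut_dominant W F S'" if "x \<in> multicut_dominant V E S" for x
      using restrict F(1) that by (rule multicut_dominant_restrict)
    show "x + incidence_vector (E - F) \<in> multicut_dominant V E S"
      if "x \<in> multicut_dominant W F S'" for x
      using extend disjoint(1) F(1) that by (rule multicut_dominant_translate)
    show "x + incidence_vector (E - F - {e}) \<in> multicut_dominant V E S"
      if "x \<in> multicut_dominant W F S'" "e \<in> E - F" for x e
      using extend_except[OF that(2)] disjoint(2) F(1) that(1) by (rule multicut_dominant_translate)
  qed (simp_all add: F(1) f_proj convex_multicut_dominant multicut_dominant_support)
  moreover have "facet_defining (multicut_polytope V E S) (\<lambda>x. \<Sum>e\<in>F. a e * x $ e) b"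
  proof (rule facet_defining_lift)
    show "facet_defining (multicut_polytope W F S') (\<lambda>x. \<Sum>e\<in>F. a e * x $ e) b"
      using assms(7) by (simp add: defines_shared_facet_def)
    show "restrict_coords F x \<in> multicut_polytope W F S'" if "x \<in> multicut_polytope V E S" for x
      using restrict that by (rule multicut_polytope_restrict)
    show "x + incidence_vector (E - F) \<in> multicut_polytope V E S"
      if "x \<in> multicut_polytope W F S'" for x
      using extend disjoint(1) that by (rule multicut_polytope_translate)
    show "x + incidence_vector (E - F - {e}) \<in> multicut_polytope V E S"
      if "x \<in> multicut_polytope W F S'" "e \<in> E - F" for x e
      using extend_except[OF that(2)] disjoint(2) that(1) by (rule multicut_polytope_translate)
  qed (simp_all add: F(1) f_proj convex_multicut_polytope multicut_polytope_support)
  ultimately show ?thesis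
    by (simp add: defines_shared_facet_def)
qed

end
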